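(* Let $M_n$ be the magnetization of the Curie–Weiss model $\mathbb{CW}_{0,1}$. For every relatively compact Borel set $B\subset\mathbb{R}$ whose boundary has Lebesgue measure $0$, $$\lim_{n\to\infty}n^{1/2}\,\mathbb{P}\big[n^{-1/4}M_n\in B\big]=\frac{2}{12^{1/4}\,\Gamma(1/4)}\,m(B),$$ where $m$ is Lebesgue measure.
   Context: The Curie–Weiss measure $\mathbb{CW}_{0,1}$ on $\sigma:\{1,\dots,n\}\to\{\pm1\}$ gives to $\sigma$ probability proportional to $\exp\big(\frac{1}{2n}(\sum_{i=1}^n\sigma(i))^2\big)$; $M_n=\sum_{i=1}^n\sigma(i)$. *)

theory Defs
  imports "HOL-Analysis.Analysis"
begin

definition cw_configs :: "nat \<Rightarrow> (nat \<Rightarrow> int) set" where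
  "cw_configs n = ({1..n} \<rightarrow>\<^sub>E {-1, 1})"

definition magnetization :: "nat \<Rightarrow> (nat \<Rightarrow> int) \<Rightarrow> int" where
  "magnetization n \<sigma> = (\<Sum>i\<in>{1..n}. \<sigma> i)"

text \<open>Unnormalized Curie-Weiss weight exp(M^2/(2n)) (beta = 1, h = 0).\<close>
definition cw_weight :: "nat \<Rightarrow> (nat \<Rightarrow> int) \<Rightarrow> real" where
  "cw_weight n \<sigma> = exp ((real_of_int (magnetization n \<sigma>))\<^sup>2 / (2 * real n))"

definition cw_prob :: "nat \<Rightarrow> (int \<Rightarrow> bool) \<Rightarrow> real" where
  "cw_prob n P =
     (\<Sum>\<sigma>\<in>{\<sigma>\<in>cw_configs n. P (magnetization n \<sigma>)}. cw_weight n \<sigma>) /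
     (\<Sum>\<sigma>\<in>cw_configs n. cw_weight n \<sigma>)"

end

theory Submission
  imports Defs "HOL-Probability.Probability" "HOL-Real_Asymp.Real_Asymp"
begin

text \<open>
  Write \<open>a\<close> for the fourth root of \<open>n\<close>. The magnetization takes the value \<open>2k - n\<close> with weight proportional to
  the binomial coefficient times \<open>exp ((2k - n)\<^sup>2 / (2n))\<close>. For \<open>2k - n\<close> of order \<open>a\<close> all these weights are
  asymptotic to the central binomial coefficient, so the weight of \<open>a B\<close> is the central coefficient times the number
  of points of \<open>a B\<close> in a lattice of mesh 2, which is asymptotically \<open>a m(B) / 2\<close>. The partition function is, by
  the Hubbard-Stratonovich transform, \<open>2 ^ n a / sqrt (2 pi)\<close> times the integral of
  \<open>exp (n (ln cosh (y / a) - (y / a)\<^sup>2 / 2))\<close>, whose integrand converges dominatedly to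
  \<open>exp (- y ^ 4 / 12)\<close>. With Wallis' asymptotics of the central coefficient, the quotient of the two
  gives the limit.
\<close>

section \<open>Reduction to binomial sums\<close>

text \<open>A configuration is encoded by its set of sites with spin 1. If this set has
  \<open>k\<close> elements, the magnetization is \<open>k - (n - k)\<close>, so grouping the sets
  by cardinality produces the binomial coefficients.\<close>

lemma sum_cw_configs:
  fixes f :: "int \<Rightarrow> real"
  shows "(\<Sum>\<sigma>\<in>cw_configs n. f (magnetization n \<sigma>)) =
         (\<Sum>k\<le>n. real (n choose k) * f (2 * int k - int n))"
proof -
  let ?T = "\<lambda>A. restrict (\<lambda>i. if i \<in> A then 1 else -1 :: int) {1..n}"
  have bij: "bij_betw ?T (Pow {1..n}) (cw_configs n)"
  proof (rule bij_betwI[where g = "\<lambda>\<sigma>. {i \<in> {1..n}. \<sigma> i = 1}"])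
    show "?T \<in> Pow {1..n} \<rightarrow> cw_configs n"
      by (auto simp: cw_configs_def PiE_def Pi_def extensional_def)
    show "?T {i \<in> {1..n}. \<sigma> i = 1} = \<sigma>" if "\<sigma> \<in> cw_configs n" for \<sigma>
      using that by (fastforce simp: cw_configs_def PiE_def Pi_def extensional_def restrict_def)
  qed auto
  have mag: "magnetization n (?T A) = 2 * int (card A) - int n" if "A \<in> Pow {1..n}" for A
  proof -
    have "magnetization n (?T A) = (\<Sum>i\<in>{1..n}. 2 * (if i \<in> A then 1 else 0) - 1)"
      unfolding magnetization_def by (intro sum.cong) auto
    also have "\<dots> = 2 * (\<Sum>i\<in>{1..n}. if i \<in> A then 1 else 0) - int n"
      by (simp add: sum_subtractf sum_distrib_left)
    also have "(\<Sum>i\<in>{1..n}. if i \<in> A then 1 else 0 :: int) = int (card A)"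
      using that by (simp add: sum.If_cases Int_absorb1 flip: sum.inter_restrict)
    finally show ?thesis .
  qed
  have "(\<Sum>\<sigma>\<in>cw_configs n. f (magnetization n \<sigma>)) =
        (\<Sum>A\<in>Pow {1..n}. f (2 * int (card A) - int n))"
    by (subst sum.reindex_bij_betw[OF bij, symmetric]) (use mag in \<open>auto intro!: sum.cong\<close>)
  also have "\<dots> = (\<Sum>k\<le>n. \<Sum>A\<in>{A \<in> Pow {1..n}. card A = k}. f (2 * int (card A) - int n))"
    by (intro sum.group[symmetric]) (auto dest: card_mono[rotated])
  also have "\<dots> = (\<Sum>k\<le>n. real (n choose k) * f (2 * int k - int n))"
    by (intro sum.cong) (auto simp: n_subsets)
  finally show ?thesis .
qed

lemma cw_prob_eq_binomial_sum:
  "cw_prob n P =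
     (\<Sum>k\<le>n. real (n choose k) * (if P (2 * int k - int n)
        then exp ((2 * real k - real n)\<^sup>2 / (2 * real n)) else 0)) /
     (\<Sum>k\<le>n. real (n choose k) * exp ((2 * real k - real n)\<^sup>2 / (2 * real n)))"
proof -
  have fin: "finite (cw_configs n)"
    by (simp add: cw_configs_def finite_PiE)
  have "(\<Sum>\<sigma>\<in>{\<sigma>\<in>cw_configs n. P (magnetization n \<sigma>)}. cw_weight n \<sigma>) =
        (\<Sum>\<sigma>\<in>cw_configs n. if P (magnetization n \<sigma>) then cw_weight n \<sigma> else 0)"
    using fin by (simp add: sum.inter_filter)
  then show ?thesis
    unfolding cw_prob_def cw_weight_def
    using sum_cw_configs[of "\<lambda>M. if P M then exp ((real_of_int M)\<^sup>2 / (2 * real n)) else 0" n]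
      sum_cw_configs[of "\<lambda>M. exp ((real_of_int M)\<^sup>2 / (2 * real n))" n]
    by (simp cong: if_cong)
qed

section \<open>Flatness and asymptotics of the central binomial coefficients\<close>

text \<open>One step away from the centre multiplies the coefficient by a factor close to 1, and a
  product of factors \<open>1 - b\<close> with \<open>b\<close> in [0, 1] is at least one minus the
  sum of the \<open>b\<close>. Together with maximality of the central coefficient this makes the
  coefficients flat at distances small against the square root of \<open>n\<close>.\<close>

lemma binomial_ge_central:
  assumes "k \<le> n"
  shows "(1 - (2 * real k - real n)\<^sup>2 / real n) * real (n choose (n div 2)) \<le> real (n choose k)"
proof -
  define c where "c = n div 2"
  define C where "C = real (n choose c)"
  have C: "C > 0" by (simp add: C_def c_def)
  \<comment> \<open>\<open>d\<close> is the distance below the centre. The losses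
    \<open>2 * (i + 1) / (c + 1)\<close> for \<open>i < d\<close> add up to
    \<open>d * (d + 1) / (c + 1)\<close>; the weaker numerator \<open>2 * d ^ 2\<close> keeps the
    bound purely quadratic.\<close>
  have *: "(1 - 2 * (real d)\<^sup>2 / real (c + 1)) * C \<le> real (n choose (c - d))" if "d \<le> c" for d
    using that
  proof (induction d)
    case 0
    then show ?case by (simp add: C_def)
  next
    case (Suc d)
    define a where "a = 2 * (real d)\<^sup>2 / real (c + 1)"
    define b where "b = 2 * (real d + 1) / real (c + 1)"
    define k where "k = c - Suc d"
    have k: "Suc k = c - d" "k < n" "real k = real c - real d - 1"
      using Suc.prems by (auto simp: k_def c_def)
    have IH: "(1 - a) * C \<le> real (n choose Suc k)"
      using Suc by (simp add: a_def k)
    have "Suc k * (n choose Suc k) = (n choose k) * (n - k)"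
      using binomial_absorb_comp[of n k] binomial_absorption[of k n] by (simp add: mult.commute)
    then have rec: "(real k + 1) * real (n choose Suc k) = (real n - real k) * real (n choose k)"
      using k(2) by (metis Suc_eq_plus1 less_imp_le_nat mult.commute of_nat_Suc of_nat_diff of_nat_mult add.commute)
    \<comment> \<open>For both parities of \<open>n\<close> the denominator \<open>n - k\<close> is
      at most \<open>c + d + 2\<close>, and \<open>k + 1 = c - d\<close>.\<close>
    have rho: "1 - b \<le> (real k + 1) / (real n - real k)"
    proof -
      have n: "real n \<le> 2 * real c + 1"
        by (simp add: c_def)
      have "1 - b \<le> 1 - 2 * (real d + 1) / (real c + 2 + real d)"
        unfolding b_def by (intro diff_left_mono divide_left_mono) auto
      also have "\<dots> = (real k + 1) / (real c + 2 + real d)"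
        by (simp add: k field_simps)
      also have "\<dots> \<le> (real k + 1) / (real n - real k)"
        using n k by (intro divide_left_mono) auto
      finally show ?thesis .
    qed
    have ab: "1 - 2 * (real (Suc d))\<^sup>2 / real (c + 1) \<le> 1 - a - b"
      by (simp add: a_def b_def divide_simps) (simp add: power2_eq_square algebra_simps)
    have nn: "a \<ge> 0" "b \<ge> 0" by (auto simp: a_def b_def)
    have "(1 - a - b) * C \<le> real (n choose k)"
    \<comment> \<open>The ratio bound is multiplied by \<open>1 - a\<close>, which has to be
      nonnegative; otherwise the claimed lower bound is itself nonpositive.\<close>
    proof (cases "a \<le> 1")
      case True
      have "(1 - a - b) * C \<le> (1 - b) * ((1 - a) * C)"
        using nn C by (simp add: algebra_simps)
      also have "\<dots> \<le> (real k + 1) / (real n - real k) * ((1 - a) * C)"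
        using rho True C by (intro mult_right_mono) auto
      also have "\<dots> \<le> (real k + 1) / (real n - real k) * real (n choose Suc k)"
        using IH k(2) by (intro mult_left_mono) auto
      also have "\<dots> = real (n choose k)"
        using rec k(2) by (simp add: field_simps)
      finally show ?thesis .
    next
      case False
      then have "(1 - a - b) * C \<le> 0"
        using nn C by (simp add: mult_nonpos_nonneg)
      then show ?thesis
        by (rule order_trans) simp
    qed
    then show ?case
      using ab C unfolding k_def by (meson mult_right_mono order.trans less_imp_le)
  qed
  have main: "(1 - (2 * real j - real n)\<^sup>2 / real n) * C \<le> real (n choose j)" if "j \<le> c" for j
  proof (cases "n = 0")
    case False
    \<comment> \<open>The rounding in \<open>n div 2\<close> is harmless in both places:
      \<open>c - j\<close> is at most \<open>n / 2 - j\<close>, and \<open>c + 1\<close> is at least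
      \<open>n / 2\<close>.\<close>
    have d: "real (c - j) \<le> (real n - 2 * real j) / 2" "2 * real j \<le> real n"
      using that by (auto simp: c_def of_nat_diff)
    have "2 * (real (c - j))\<^sup>2 / real (c + 1) \<le> 2 * ((real n - 2 * real j) / 2)\<^sup>2 / (real n / 2)"
      using False d by (intro frac_le mult_left_mono power_mono) (auto simp: c_def)
    also have "\<dots> = (2 * real j - real n)\<^sup>2 / real n"
      using False by (simp add: field_simps power2_eq_square)
    finally have "(1 - (2 * real j - real n)\<^sup>2 / real n) * C \<le> (1 - 2 * (real (c - j))\<^sup>2 / real (c + 1)) * C"
      using C by (intro mult_right_mono) auto
    also have "\<dots> \<le> real (n choose j)"
      using *[of "c - j"] that by simp
    finally show ?thesis .
  qed (use that in \<open>auto simp: C_def c_def\<close>)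
  show ?thesis
  proof (cases "k \<le> c")
    case True
    then show ?thesis using main[of k] by (simp add: C_def c_def)
  next
    case False
    \<comment> \<open>The upper half follows by the reflection of \<open>k\<close> to
      \<open>n - k\<close>, which preserves the coefficient and the squared deviation.\<close>
    have "(2 * real (n - k) - real n)\<^sup>2 = (2 * real k - real n)\<^sup>2"
      using assms by (simp add: of_nat_diff power2_eq_square algebra_simps)
    then show ?thesis
      using main[of "n - k"] False assms by (simp add: C_def c_def binomial_symmetric[of k n])
  qed
qed

text \<open>Links the Wallis product, whose limit is \<open>pi / 2\<close>, to the central binomial
  coefficients. The induction rests on the growth factor \<open>2 * (2 * n + 1) / (n + 1)\<close> of
  these coefficients.\<close>

lemma wallis_prod_eq:
  "(\<Prod>k=1..n. (4 * real k ^ 2) / (4 * real k ^ 2 - 1)) =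
     16 ^ n / (real ((2 * n) choose n) ^ 2 * (2 * real n + 1))"
proof (induction n)
  case (Suc n)
  have c: "real ((2 * Suc n) choose (Suc n)) = 2 * (2 * real n + 1) / (real n + 1) * real ((2 * n) choose n)"
  proof -
    have "2 * Suc n - Suc n = Suc n" "2 * n - n = n" "2 * Suc n = Suc (Suc (2 * n))"
      by auto
    then have e: "real ((2 * Suc n) choose (Suc n)) = fact (Suc (Suc (2 * n))) / (fact (Suc n) * fact (Suc n))"
      and e': "real ((2 * n) choose n) = fact (2 * n) / (fact n * fact n)"
      by (metis binomial_fact le_add1 mult_2)+
    show ?thesis
      unfolding e e' by (simp add: divide_simps) (simp add: algebra_simps)
  qed
  define C where "C = real ((2 * n) choose n)"
  have "C > 0" by (simp add: C_def)
  have "(4 * real (Suc n) ^ 2) / (4 * real (Suc n) ^ 2 - 1) =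
      (4 * (real n + 1) ^ 2) / ((2 * real n + 1) * (2 * real n + 3))"
    by (simp add: power2_eq_square algebra_simps)
  then have "(\<Prod>k=1..Suc n. (4 * real k ^ 2) / (4 * real k ^ 2 - 1)) =
      (4 * (real n + 1) ^ 2) / ((2 * real n + 1) * (2 * real n + 3)) * (16 ^ n / (C\<^sup>2 * (2 * real n + 1)))"
    using Suc by (simp add: C_def mult_ac)
  also have "\<dots> = 16 ^ Suc n / ((2 * (2 * real n + 1) / (real n + 1) * C)\<^sup>2 * (2 * real (Suc n) + 1))"
    using \<open>C > 0\<close> by (simp add: divide_simps) (simp add: power2_eq_square algebra_simps)
  finally show ?case
    unfolding c C_def .
qed simp

text \<open>The square of the sequence is \<open>2 * n / (2 * n + 1)\<close>, which tends to 1,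
  divided by the Wallis product.\<close>

lemma central_binomial_even_asymp:
  "(\<lambda>n. real ((2 * n) choose n) * sqrt (real (2 * n)) / 2 ^ (2 * n)) \<longlonglongrightarrow> sqrt (2 / pi)"
proof -
  have "(\<lambda>n. sqrt (real (2 * n) / (2 * real n + 1) /
       (\<Prod>k=1..n. (4 * real k ^ 2) / (4 * real k ^ 2 - 1)))) \<longlonglongrightarrow> sqrt (1 / (pi / 2))"
    by (intro tendsto_intros wallis) (real_asymp | simp)+
  moreover have "sqrt (real (2 * n) / (2 * real n + 1) /
       (\<Prod>k=1..n. (4 * real k ^ 2) / (4 * real k ^ 2 - 1))) =
       real ((2 * n) choose n) * sqrt (real (2 * n)) / 2 ^ (2 * n)" for n
  proof -
    have "(real (2 * n) / (2 * real n + 1) /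
       (\<Prod>k=1..n. (4 * real k ^ 2) / (4 * real k ^ 2 - 1))) =
       (real ((2 * n) choose n) * sqrt (real (2 * n)) / 2 ^ (2 * n))\<^sup>2"
      unfolding wallis_prod_eq by (simp add: power_divide power_mult_distrib power_mult power2_eq_square flip: power_mult_distrib)
    then show ?thesis by simp
  qed
  ultimately show ?thesis by simp
qed

text \<open>Odd indices reduce to even ones: by Pascal's rule and symmetry,
  \<open>(2 * n + 1) choose n\<close> is half of the next even central coefficient, and the square
  roots differ by a factor tending to 1.\<close>

lemma central_binomial_asymp:
  "(\<lambda>n. real (n choose (n div 2)) * sqrt (real n) / 2 ^ n) \<longlonglongrightarrow> sqrt (2 / pi)"
proof (rule limseq_even_odd)
  let ?f = "\<lambda>n. real ((2 * n) choose n) * sqrt (real (2 * n)) / 2 ^ (2 * n)"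
  show "(\<lambda>n. real ((2 * n) choose ((2 * n) div 2)) * sqrt (real (2 * n)) / 2 ^ (2 * n)) \<longlonglongrightarrow> sqrt (2 / pi)"
    using central_binomial_even_asymp by simp
  have "(\<lambda>n. ?f (Suc n) * sqrt (real (2 * n + 1) / real (2 * Suc n))) \<longlonglongrightarrow> sqrt (2 / pi) * sqrt 1"
    by (intro tendsto_intros LIMSEQ_Suc[OF central_binomial_even_asymp]) real_asymp
  moreover have "?f (Suc n) * sqrt (real (2 * n + 1) / real (2 * Suc n)) =
    real ((2 * n + 1) choose ((2 * n + 1) div 2)) * sqrt (real (2 * n + 1)) / 2 ^ (2 * n + 1)" for n
  proof -
    have "(2 * Suc n) choose Suc n = 2 * ((2 * n + 1) choose n)"
      using binomial_symmetric[of n "2 * n + 1"] by simp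
    then show ?thesis
      by (simp add: real_sqrt_divide)
  qed
  ultimately show "(\<lambda>n. real ((2 * n + 1) choose ((2 * n + 1) div 2)) * sqrt (real (2 * n + 1)) / 2 ^ (2 * n + 1))
     \<longlonglongrightarrow> sqrt (2 / pi)" by simp
qed

section \<open>Quartic bound and quartic limit for the logarithm of cosh\<close>

lemma ln_cosh_le:
  fixes t :: real
  shows "ln (cosh t) \<le> t\<^sup>2 / 2 - t ^ 4 / (24 * (1 + t\<^sup>2))"
proof -
  \<comment> \<open>For t \<ge> 0 integrate twice the inequality of second derivatives, which reduces to tanh t \<ge> t / (1 + t);
    the constant 24 is what makes that reduction work.\<close>
  have pos: "1 + x\<^sup>2 > 0" for x :: real
    by (simp add: add_pos_nonneg)
  have nz: "1 + x\<^sup>2 \<noteq> 0" for x :: real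
    using pos[of x] by simp
  have tanh_ge: "tanh x \<ge> x / (1 + x)" if "x \<ge> 0" for x :: real
  proof -
    have "1 + 2 * x \<le> exp (2 * x)" by (rule exp_ge_add_one_self)
    then have "(1 + 2 * x) * exp (- 2 * x) \<le> exp (2 * x) * exp (- 2 * x)"
      by (intro mult_right_mono) auto
    \<comment> \<open>Clearing denominators with \<open>tanh x\<close> written in
      \<open>exp (- 2 * x)\<close> turns the claim into exactly this inequality.\<close>
    then have "(1 + 2 * x) * exp (- 2 * x) \<le> 1"
      by (simp flip: exp_add)
    moreover have "1 + exp (- 2 * x) > 0" by (simp add: add_pos_pos)
    ultimately show ?thesis using that unfolding tanh_real_altdef
      by (simp add: divide_simps) (simp add: algebra_simps)
  qed
  \<comment> \<open>The right-hand side is the second derivative of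
    \<open>x ^ 4 / (24 * (1 + x ^ 2))\<close>. It is at most \<open>x ^ 2 / (2 * q)\<close>, the gap
    having numerator \<open>(q - 1) ^ 2 * (5 * q + 4)\<close>, and \<open>(1 + x) ^ 2\<close> is at
    most \<open>2 * q\<close>.\<close>
  have deriv2: "(x / (1 + x))\<^sup>2 \<ge> ((1 + x\<^sup>2) ^ 3 - 1 + 3 * x\<^sup>2) / (12 * (1 + x\<^sup>2) ^ 3)" if "x \<ge> 0" for x :: real
  proof -
    define q where "q = 1 + x\<^sup>2"
    have q: "q \<ge> 1" "x\<^sup>2 = q - 1" by (auto simp: q_def)
    have 1: "q ^ 3 - 1 + 3 * (q - 1) \<le> 6 * (q - 1) * q\<^sup>2"
    proof -
      have "6 * (q - 1) * q\<^sup>2 - (q ^ 3 - 1 + 3 * (q - 1)) = (q - 1) * (5 * q\<^sup>2 - q - 4)"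
        by (simp add: power2_eq_square power3_eq_cube algebra_simps)
      also have "5 * q\<^sup>2 - q - 4 = (q - 1) * (5 * q + 4)"
        by (simp add: power2_eq_square algebra_simps)
      also have "(q - 1) * ((q - 1) * (5 * q + 4)) \<ge> 0"
        using q by (intro mult_nonneg_nonneg) auto
      finally show ?thesis by simp
    qed
    have "(q ^ 3 - 1 + 3 * (q - 1)) / (12 * q ^ 3) \<le> (6 * (q - 1) * q\<^sup>2) / (12 * q ^ 3)"
      using 1 q by (intro divide_right_mono) auto
    also have "\<dots> = (q - 1) / (2 * q)"
      using q(1) by (simp add: power2_eq_square power3_eq_cube) (simp add: field_simps)
    also have "\<dots> = x\<^sup>2 / (2 * q)"
      by (simp add: q_def)
    also have "\<dots> \<le> x\<^sup>2 / (1 + x)\<^sup>2"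
    proof (intro divide_left_mono)
      have "0 \<le> (x - 1)\<^sup>2" by simp
      then show "(1 + x)\<^sup>2 \<le> 2 * q" by (simp add: q_def power2_eq_square algebra_simps)
      show "0 < 2 * q * (1 + x)\<^sup>2" using q that by (intro mult_pos_pos) auto
    qed simp
    finally show ?thesis by (simp add: q_def power_divide)
  qed
  have d1: "x - tanh x \<ge> (x\<^sup>2 * x * (2 + x\<^sup>2)) / (12 * (1 + x\<^sup>2)\<^sup>2)" if "x \<ge> 0" for x :: real
  proof -
    let ?f = "\<lambda>x::real. x - tanh x - (x\<^sup>2 * x * (2 + x\<^sup>2)) / (12 * (1 + x\<^sup>2)\<^sup>2)"
    have "?f 0 \<le> ?f x"
    proof (rule DERIV_nonneg_imp_nondecreasing[OF that])
      fix u :: real assume u: "0 \<le> u" "u \<le> x"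
      \<comment> \<open>First integration: \<open>x - tanh x\<close> has derivative
        \<open>tanh x ^ 2\<close>.\<close>
      have deriv: "(?f has_real_derivative ((tanh u)\<^sup>2 - ((1 + u\<^sup>2) ^ 3 - 1 + 3 * u\<^sup>2) / (12 * (1 + u\<^sup>2) ^ 3))) (at u)"
        using nz[of u]
        apply (auto intro!: derivative_eq_intros)
        apply (simp add: divide_simps)
        apply (simp add: algebra_simps eval_nat_numeral)
        done
      have "(tanh u)\<^sup>2 \<ge> (u / (1 + u))\<^sup>2"
        using u tanh_ge[of u] by (intro power_mono) auto
      then have "0 \<le> (tanh u)\<^sup>2 - ((1 + u\<^sup>2) ^ 3 - 1 + 3 * u\<^sup>2) / (12 * (1 + u\<^sup>2) ^ 3)"
        using deriv2[OF u(1)] by linarith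
      with deriv show "\<exists>y. (?f has_real_derivative y) (at u) \<and> 0 \<le> y"
        by blast
    qed
    then show ?thesis by simp
  qed
  have main: "ln (cosh x) \<le> x\<^sup>2 / 2 - x ^ 4 / (24 * (1 + x\<^sup>2))" if "x \<ge> 0" for x :: real
  proof -
    let ?f = "\<lambda>x::real. x\<^sup>2 / 2 - x ^ 4 / (24 * (1 + x\<^sup>2)) - ln (cosh x)"
    have "?f 0 \<le> ?f x"
    proof (rule DERIV_nonneg_imp_nondecreasing[OF that])
      fix u :: real assume u: "0 \<le> u" "u \<le> x"
      \<comment> \<open>Second integration: \<open>x ^ 2 / 2 - ln (cosh x)\<close> has derivative
        \<open>x - tanh x\<close>.\<close>
      have deriv: "(?f has_real_derivative (u - tanh u - (u\<^sup>2 * u * (2 + u\<^sup>2)) / (12 * (1 + u\<^sup>2)\<^sup>2))) (at u)"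
        using nz[of u] cosh_real_pos[of u]
        apply (auto intro!: derivative_eq_intros simp: tanh_def)
        apply (simp add: divide_simps)
        apply (simp add: algebra_simps eval_nat_numeral)
        done
      moreover have "0 \<le> u - tanh u - (u\<^sup>2 * u * (2 + u\<^sup>2)) / (12 * (1 + u\<^sup>2)\<^sup>2)"
        using d1[OF u(1)] by linarith
      ultimately show "\<exists>y. (?f has_real_derivative y) (at u) \<and> 0 \<le> y"
        by blast
    qed
    then show ?thesis by simp
  qed
  show ?thesis using main[of t] main[of "-t"] by (cases "t \<ge> 0") auto
qed

text \<open>At the critical temperature the Gaussian cancels the quadratic Taylor term of
  \<open>ln (cosh t)\<close>. The next term, \<open>- t ^ 4 / 12\<close>, is the source of the scale
  \<open>n powr (1/4)\<close> and of the constant 12.\<close>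

lemma ln_cosh_quartic:
  "((\<lambda>t::real. (ln (cosh t) - t\<^sup>2 / 2) / t ^ 4) \<longlongrightarrow> - 1 / 12) (at 0)"
  unfolding cosh_def by simp real_asymp

section \<open>The quartic integral\<close>

text \<open>The substitution \<open>t = y ^ 4 / 12\<close> turns Euler's integral for
  \<open>Gamma (1/4)\<close> into the integral over the positive half-line; evenness doubles
  it.\<close>

lemma integral_exp_quartic:
  "integrable lborel (\<lambda>y::real. exp (- (y ^ 4 / 12)))"
  "(\<integral>y. exp (- (y ^ 4 / 12 :: real)) \<partial>lborel) = 12 powr (1/4) * Gamma (1/4) / 2"
proof -
  let ?f = "\<lambda>y::real. exp (- (y ^ 4 / 12))"
  let ?G = "\<lambda>t::real. t powr (1/4 - 1) / exp t"
  have img: "(\<lambda>y::real. y ^ 4 / 12) ` {0<..} = {0<..}"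
  proof safe
    fix t :: real assume "0 < t"
    then have "t = (root 4 (12 * t)) ^ 4 / 12" "root 4 (12 * t) > 0"
      by auto
    then show "t \<in> (\<lambda>y::real. y ^ 4 / 12) ` {0<..}" by blast
  qed auto
  have inj: "inj_on (\<lambda>y::real. y ^ 4 / 12) {0<..}"
    by (auto intro!: inj_onI simp: power_eq_iff_eq_base)
  \<comment> \<open>The point 0 is removed because the transformed integrand vanishes there and so
    violates \<open>eq\<close>; it is negligible for both integrals.\<close>
  have open_half: "(f has_integral I) {0<..} \<longleftrightarrow> (f has_integral I) {0..}" for f :: "real \<Rightarrow> real" and I
    by (rule has_integral_spike_set_eq) (auto intro: negligible_subset[of "{0}"])
  have hi: "(?G has_integral Gamma (1/4)) {0<..}"
    using Gamma_integral_real[of "1/4"] by (simp add: open_half)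
  have "?G absolutely_integrable_on {0<..} \<and> integral {0<..} ?G = Gamma (1/4)"
    using hi by (auto intro!: nonnegative_absolutely_integrable_1 simp: integral_unique)
  then have *: "(\<lambda>y. \<bar>y ^ 3 / 3\<bar> * ?G (y ^ 4 / 12)) absolutely_integrable_on {0<..} \<and>
      integral {0<..} (\<lambda>y. \<bar>y ^ 3 / 3\<bar> * ?G (y ^ 4 / 12)) = Gamma (1/4)"
    by (subst has_absolute_integral_change_of_variables_1')
       (auto simp: img inj intro!: derivative_eq_intros)
  \<comment> \<open>The power \<open>-3/4\<close> of \<open>y ^ 4 / 12\<close> cancels the Jacobian
    \<open>y ^ 3 / 3\<close> up to a constant.\<close>
  have eq: "\<bar>y ^ 3 / 3\<bar> * ?G (y ^ 4 / 12) = 12 powr (3/4) / 3 * ?f y" if "y \<in> {0<..}" for y :: real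
  proof -
    have "(y ^ 4) powr (- (3/4)) = (y powr 4) powr (- (3/4))"
      using that by simp
    also have "\<dots> = y powr (- 3)"
      by (simp only: powr_powr) simp
    also have "\<dots> = 1 / y ^ 3"
      using that by (simp add: powr_minus divide_inverse)
    finally have y4: "(y ^ 4) powr (- (3/4)) = 1 / y ^ 3" .
    have "(y ^ 4 / 12) powr (1/4 - 1) = (y ^ 4) powr (- (3/4)) / 12 powr (- (3/4))"
      by (simp add: powr_divide)
    also have "\<dots> = 12 powr (3/4) / y ^ 3"
      unfolding y4 by (simp add: powr_minus field_simps)
    finally have "(y ^ 4 / 12) powr (1/4 - 1) = 12 powr (3/4) / y ^ 3" .
    then show ?thesis
      using that by (simp add: exp_minus field_simps)
  qed
  have "((\<lambda>y. \<bar>y ^ 3 / 3\<bar> * ?G (y ^ 4 / 12)) has_integral Gamma (1/4)) {0<..}"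
    using integrable_integral[OF set_lebesgue_integral_eq_integral(1)[OF conjunct1[OF *]]]
    unfolding conjunct2[OF *] .
  then have "((\<lambda>y. 12 powr (3/4) / 3 * ?f y) has_integral Gamma (1/4)) {0<..}"
    using eq by (rule has_integral_eq[rotated])
  then have "((\<lambda>y. 3 / 12 powr (3/4) * (12 powr (3/4) / 3 * ?f y)) has_integral 3 / 12 powr (3/4) * Gamma (1/4)) {0<..}"
    by (rule has_integral_mult_right)
  moreover have "3 / 12 powr (3/4) * (12 powr (3/4) / 3 * z) = z" for z :: real
    by simp
  moreover have "(3 :: real) / 12 powr (3/4) = 12 powr (1/4) / 4"
  proof -
    have "(12 :: real) powr (1/4) * 12 powr (3/4) = 12"
      by (simp flip: powr_add)
    then show ?thesis by (simp add: field_simps)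
  qed
  ultimately have "(?f has_integral 12 powr (1/4) / 4 * Gamma (1/4)) {0<..}"
    by (simp only:)
  then have hi0: "(?f has_integral 12 powr (1/4) * Gamma (1/4) / 4) {0..}"
    by (simp add: open_half)
  have "(\<integral>\<^sup>+x. indicator {0..} x * ?f x \<partial>lborel) = ennreal (12 powr (1/4) * Gamma (1/4) / 4)"
    by (rule nn_integral_has_integral_lebesgue[OF _ hi0]) auto
  then have "has_bochner_integral lborel (\<lambda>x. indicator {0..} x *\<^sub>R ?f x) (12 powr (1/4) * Gamma (1/4) / 4)"
    by (intro has_bochner_integral_nn_integral) auto
  then have "has_bochner_integral lborel ?f (2 *\<^sub>R (12 powr (1/4) * Gamma (1/4) / 4))"
    by (rule has_bochner_integral_even_function) auto
  then show "integrable lborel ?f" "(\<integral>y. ?f y \<partial>lborel) = 12 powr (1/4) * Gamma (1/4) / 2"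
    by (auto simp: has_bochner_integral_iff)
qed

section \<open>The partition function and its limit\<close>

text \<open>The Hubbard-Stratonovich transform: the square in the exponent is linearised by a Gaussian integral,
  after which the sum over \<open>k\<close> is a binomial expansion.\<close>
lemma cw_partition_function:
  fixes n :: nat and a :: real
  assumes "n > 0" and a: "a = real n powr (1/4)"
  shows "(\<Sum>k\<le>n. real (n choose k) * exp ((2 * real k - real n)\<^sup>2 / (2 * real n))) =
         2 ^ n * a / sqrt (2 * pi) * (\<integral>y. cosh (y / a) ^ n * exp (- (a\<^sup>2 * y\<^sup>2 / 2)) \<partial>lborel)"
proof -
  have a0: "a > 0" using assms by simp
  have a4: "a ^ 4 = real n"
    using assms by (simp add: powr_powr flip: powr_numeral)
  define m where "m k = 2 * real k - real n" for k
  \<comment> \<open>Completing the square with \<open>a ^ 4 = n\<close> exhibits a multiple of the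
    normal density with mean \<open>m k / a ^ 3\<close> and standard deviation
    \<open>1 / a\<close>.\<close>
  have gauss: "has_bochner_integral lborel (\<lambda>y. exp (m k * (y / a) - a\<^sup>2 * y\<^sup>2 / 2))
                 (sqrt (2 * pi) / a * exp ((m k)\<^sup>2 / (2 * real n)))" for k
  proof -
    have "has_bochner_integral lborel (\<lambda>y. sqrt (2 * pi) / a * exp ((m k)\<^sup>2 / (2 * real n)) * normal_density (m k / a ^ 3) (1 / a) y)
        (sqrt (2 * pi) / a * exp ((m k)\<^sup>2 / (2 * real n)) * 1)"
      using a0 by (intro has_bochner_integral_mult_right) (simp add: has_bochner_integral_iff)
    moreover have "sqrt (2 * pi) / a * exp ((m k)\<^sup>2 / (2 * real n)) * normal_density (m k / a ^ 3) (1 / a) y =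
        exp (m k * (y / a) - a\<^sup>2 * y\<^sup>2 / 2)" for y
    proof -
      have "(m k)\<^sup>2 / (2 * real n) - (y - m k / a ^ 3)\<^sup>2 / (2 * (1 / a)\<^sup>2) = m k * (y / a) - a\<^sup>2 * y\<^sup>2 / 2"
        unfolding a4[symmetric] using a0
        by (simp add: divide_simps) (simp add: algebra_simps eval_nat_numeral)
      moreover have "sqrt (2 * pi) / a * (1 / sqrt (2 * pi * (1 / a)\<^sup>2)) = 1"
        using a0 by (simp add: real_sqrt_mult real_sqrt_divide)
      moreover have "c * exp u * (d * exp (- v)) = exp (u - v)" if "c * d = 1" for c d u v :: real
      proof -
        have "c * exp u * (d * exp (- v)) = (c * d) * exp (u - v)"
          by (simp add: exp_diff exp_minus divide_inverse)
        then show ?thesis using that by simp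
      qed
      ultimately show ?thesis
        unfolding normal_density_def minus_divide_left[symmetric] by metis
    qed
    ultimately show ?thesis by simp
  qed
  have "has_bochner_integral lborel (\<lambda>y. \<Sum>k\<le>n. real (n choose k) * exp (m k * (y / a) - a\<^sup>2 * y\<^sup>2 / 2))
     (\<Sum>k\<le>n. real (n choose k) * (sqrt (2 * pi) / a * exp ((m k)\<^sup>2 / (2 * real n))))"
    by (intro has_bochner_integral_sum has_bochner_integral_mult_right gauss)
  moreover have "(\<Sum>k\<le>n. real (n choose k) * exp (m k * (y / a) - a\<^sup>2 * y\<^sup>2 / 2)) =
      2 ^ n * (cosh (y / a) ^ n * exp (- (a\<^sup>2 * y\<^sup>2 / 2)))" for y
  proof -
    \<comment> \<open>Since \<open>m k = k - (n - k)\<close>, the sum is the binomial expansion of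
      \<open>(2 * cosh (y / a)) ^ n\<close>.\<close>
    have "exp (m k * (y / a)) = exp (y / a) ^ k * exp (- (y / a)) ^ (n - k)" if "k \<le> n" for k
      using that by (simp add: m_def of_nat_diff algebra_simps flip: exp_of_nat_mult exp_add)
    then have "(\<Sum>k\<le>n. real (n choose k) * exp (m k * (y / a))) = (exp (y / a) + exp (- (y / a))) ^ n"
      by (simp add: binomial_ring mult.assoc)
    also have "exp (y / a) + exp (- (y / a)) = 2 * cosh (y / a)"
      by (simp add: cosh_def)
    finally have "(\<Sum>k\<le>n. real (n choose k) * exp (m k * (y / a))) = 2 ^ n * cosh (y / a) ^ n"
      by (simp add: power_mult_distrib)
    moreover have "(\<Sum>k\<le>n. real (n choose k) * exp (m k * (y / a) - a\<^sup>2 * y\<^sup>2 / 2)) =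
        (\<Sum>k\<le>n. real (n choose k) * exp (m k * (y / a))) * exp (- (a\<^sup>2 * y\<^sup>2 / 2))"
      unfolding sum_distrib_right
      by (simp only: diff_conv_add_uminus exp_add mult.assoc)
    ultimately show ?thesis
      by simp
  qed
  ultimately have "(\<integral>y. 2 ^ n * (cosh (y / a) ^ n * exp (- (a\<^sup>2 * y\<^sup>2 / 2))) \<partial>lborel) =
      (\<Sum>k\<le>n. real (n choose k) * (sqrt (2 * pi) / a * exp ((m k)\<^sup>2 / (2 * real n))))"
    by (simp add: has_bochner_integral_iff)
  also have "\<dots> = sqrt (2 * pi) / a * (\<Sum>k\<le>n. real (n choose k) * exp ((m k)\<^sup>2 / (2 * real n)))"
    by (simp add: sum_distrib_left mult_ac)
  finally show ?thesis
    using a0 by (simp add: m_def field_simps)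
qed

text \<open>Brings the integrand into the form to which the bound and the limit for
  \<open>ln (cosh t)\<close> apply, with \<open>t = y / a\<close>.\<close>

lemma cosh_gauss_eq_exp:
  fixes a :: real
  assumes "a > 0" "a ^ 4 = real n"
  shows "cosh (y / a) ^ n * exp (- (a\<^sup>2 * y\<^sup>2 / 2)) =
         exp (a ^ 4 * (ln (cosh (y / a)) - (y / a)\<^sup>2 / 2))"
proof -
  have "a ^ 4 * ((y / a)\<^sup>2 / 2) = a\<^sup>2 * y\<^sup>2 / 2"
    using assms(1) by (simp add: power_divide eval_nat_numeral)
  then have "exp (a ^ 4 * (ln (cosh (y / a)) - (y / a)\<^sup>2 / 2)) = exp (ln (cosh (y / a)) * real n - a\<^sup>2 * y\<^sup>2 / 2)"
    using assms by (simp add: algebra_simps)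
  then show ?thesis
    by (simp only: diff_conv_add_uminus exp_add exp_of_nat2_mult exp_ln cosh_real_pos)
qed

text \<open>Dominated convergence: \<open>ln_cosh_quartic\<close> gives the pointwise limit, and
  \<open>ln_cosh_le\<close> a Gaussian majorant independent of \<open>n\<close>.\<close>

lemma cw_partition_integral_tendsto:
  "(\<lambda>n. \<integral>y. cosh (y / real n powr (1/4)) ^ n * exp (- ((real n powr (1/4))\<^sup>2 * y\<^sup>2 / 2)) \<partial>lborel)
     \<longlonglongrightarrow> 12 powr (1/4) * Gamma (1/4) / 2"
proof -
  define a where "a n = real n powr (1/4)" for n
  have a0: "a n > 0" if "n > 0" for n
    using that by (simp add: a_def)
  have a1: "a n \<ge> 1" if "n > 0" for n
    using that by (simp add: a_def ge_one_powr_ge_zero)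
  have a4: "a n ^ 4 = real n" if "n > 0" for n
    using that by (simp add: a_def powr_powr flip: powr_numeral)
  let ?s = "\<lambda>n y. cosh (y / a n) ^ n * exp (- ((a n)\<^sup>2 * y\<^sup>2 / 2))"
  let ?w = "\<lambda>y::real. exp ((1 - y\<^sup>2) / 24)"
  have bound: "?s n y \<le> ?w y" if "n > 0" for n y
  proof -
    define t where "t = y / a n"
    have y: "y = a n * t" using a0[OF that] by (simp add: t_def)
    have "a n ^ 4 * (ln (cosh t) - t\<^sup>2 / 2) \<le> a n ^ 4 * (- (t ^ 4 / (24 * (1 + t\<^sup>2))))"
      using ln_cosh_le[of t] by (intro mult_left_mono) auto
    also have "\<dots> = - (y ^ 4 / (24 * (1 + t\<^sup>2)))"
      by (simp add: y power_mult_distrib)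
    \<comment> \<open>As \<open>a n\<close> is at least 1, replacing \<open>t\<close> by
      \<open>y\<close> in the denominator removes the dependence on \<open>n\<close>.\<close>
    also have "\<dots> \<le> - (y ^ 4 / (24 * (1 + y\<^sup>2)))"
    proof -
      have "t\<^sup>2 * 1 \<le> t\<^sup>2 * (a n)\<^sup>2"
        using a1[OF that] by (intro mult_left_mono) auto
      then have "1 + t\<^sup>2 \<le> 1 + y\<^sup>2" by (simp add: y power_mult_distrib mult_ac)
      then show ?thesis
        by (intro le_imp_neg_le divide_left_mono) (auto intro!: mult_pos_pos add_pos_nonneg)
    qed
    \<comment> \<open>Uses \<open>y ^ 4 - 1 = (y ^ 2 - 1) * (y ^ 2 + 1)\<close>.\<close>
    also have "\<dots> \<le> (1 - y\<^sup>2) / 24"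
    proof -
      have "1 + y\<^sup>2 > 0" by (auto intro: add_pos_nonneg)
      then show ?thesis by (simp add: field_simps eval_nat_numeral)
    qed
    finally show ?thesis
      unfolding cosh_gauss_eq_exp[OF a0[OF that] a4[OF that]] unfolding t_def[symmetric] by simp
  qed
  have nonneg: "0 \<le> ?s n y" for n y
    by (intro mult_nonneg_nonneg zero_le_power) auto
  have lim: "(\<lambda>n. ?s n y) \<longlonglongrightarrow> exp (- (y ^ 4 / 12))" for y
  \<comment> \<open>The quartic limit is taken along nonzero arguments; at \<open>y = 0\<close> the
    integrand is constantly 1.\<close>
  proof (cases "y = 0")
    case False
    have "(\<lambda>n. 1 / a n) \<longlonglongrightarrow> 0"
      unfolding a_def by real_asymp
    then have "(\<lambda>n. y / a n) \<longlonglongrightarrow> 0"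
      using tendsto_mult_left[of "\<lambda>n. 1 / a n" 0 sequentially y] by simp
    moreover have "eventually (\<lambda>n. y / a n \<noteq> 0) sequentially"
      using eventually_gt_at_top[of 0]
    proof eventually_elim
      case (elim n)
      then show ?case using False a0[of n] by simp
    qed
    ultimately have "filterlim (\<lambda>n. y / a n) (at 0) sequentially"
      by (simp add: filterlim_at)
    from filterlim_compose[OF ln_cosh_quartic this]
    have "(\<lambda>n. exp (y ^ 4 * ((ln (cosh (y / a n)) - (y / a n)\<^sup>2 / 2) / (y / a n) ^ 4)))
        \<longlonglongrightarrow> exp (y ^ 4 * (- 1 / 12))"
      by (rule tendsto_exp[OF tendsto_mult_left])
    moreover have "eventually (\<lambda>n. exp (y ^ 4 * ((ln (cosh (y / a n)) - (y / a n)\<^sup>2 / 2) / (y / a n) ^ 4)) = ?s n y) sequentially"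
      using eventually_gt_at_top[of 0]
    proof eventually_elim
      case (elim n)
      have "y ^ 4 * (X / (y / a n) ^ 4) = a n ^ 4 * X" for X
        using a0[OF elim] False by (simp add: power_divide)
      then show ?case
        unfolding cosh_gauss_eq_exp[OF a0[OF elim] a4[OF elim]] by simp
    qed
    ultimately show ?thesis
      by (simp add: tendsto_cong)
  qed simp
  have w: "integrable lborel ?w"
  proof -
    have "integrable lborel (\<lambda>y. exp (1/24) * sqrt (2 * pi * 12) * normal_density 0 (sqrt 12) y)"
      by (intro integrable_mult_right) auto
    moreover have "exp (1/24) * sqrt (2 * pi * 12) * normal_density 0 (sqrt 12) y = ?w y" for y
    proof -
      have "(1 - y\<^sup>2) / 24 = 1 / 24 + - (y - 0)\<^sup>2 / (2 * (sqrt 12)\<^sup>2)"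
        by (simp add: field_simps)
      then show ?thesis
        unfolding normal_density_def by (simp only: exp_add) simp
    qed
    ultimately show ?thesis by (simp only:)
  qed
  \<comment> \<open>The index is shifted because the majorant fails at \<open>n = 0\<close>, where
    the integrand is constantly 1.\<close>
  have "(\<lambda>n. \<integral>y. ?s (Suc n) y \<partial>lborel) \<longlonglongrightarrow> (\<integral>y. exp (- (y ^ 4 / 12)) \<partial>lborel)"
  proof (rule integral_dominated_convergence[where w = ?w])
    show "(\<lambda>y. cosh (y / a (Suc n)) ^ Suc n * exp (- ((a (Suc n))\<^sup>2 * y\<^sup>2 / 2))) \<in> borel_measurable lborel" for n
      unfolding cosh_def by measurable
    show "AE y in lborel. (\<lambda>n. ?s (Suc n) y) \<longlonglongrightarrow> exp (- (y ^ 4 / 12))"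
      by (rule AE_I2, rule LIMSEQ_Suc, rule lim)
    show "AE y in lborel. norm (?s (Suc n) y) \<le> ?w y" for n
      using bound[OF zero_less_Suc] by (intro AE_I2) (simp only: real_norm_def abs_of_nonneg[OF nonneg])
  qed (use w in auto)
  then show ?thesis
    unfolding integral_exp_quartic a_def by (rule LIMSEQ_imp_Suc)
qed

section \<open>Lattice sums as integrals of step functions\<close>

text \<open>The half-open cells are disjoint, and cell \<open>k\<close> contains \<open>x\<close>
  exactly when the floor \<open>j\<close> equals \<open>k\<close>; hence at most one summand
  survives.\<close>

lemma sum_indicator_lattice:
  fixes a x :: real and g :: "nat \<Rightarrow> real" and n :: nat
  assumes "a > 0"
  defines "j \<equiv> \<lfloor>(a * x + real n) / 2\<rfloor>"
  shows "(\<Sum>k\<le>n. g k * indicator {(2 * real k - real n) / a ..< (2 * real k - real n) / a + 2 / a} x) =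
         (if 0 \<le> j \<and> j \<le> int n then g (nat j) else 0)"
proof -
  have ind: "indicator {(2 * real k - real n) / a ..< (2 * real k - real n) / a + 2 / a} x =
        (if j = int k then 1 else 0 :: real)" for k
  proof -
    have "(2 * real k - real n) / a \<le> x \<longleftrightarrow> real k \<le> (a * x + real n) / 2"
      using assms(1) by (auto simp: field_simps)
    moreover have "x < (2 * real k - real n) / a + 2 / a \<longleftrightarrow> (a * x + real n) / 2 < real k + 1"
      using assms(1) by (auto simp: field_simps)
    ultimately have "x \<in> {(2 * real k - real n) / a ..< (2 * real k - real n) / a + 2 / a} \<longleftrightarrow> j = int k"
      unfolding j_def floor_eq_iff by simp
    then show ?thesis
      by (simp only: indicator_def of_bool_def)
  qed
  show ?thesis
  proof (cases "0 \<le> j \<and> j \<le> int n")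
    case True
    then have "j = int k \<longleftrightarrow> k = nat j" for k by auto
    with True show ?thesis
      unfolding ind by (simp add: if_distrib cong: if_cong) linarith
  next
    case False
    then have "j \<noteq> int k" if "k \<le> n" for k using that by auto
    with False show ?thesis
      unfolding ind by (auto intro!: sum.neutral)
  qed
qed

lemma integral_sum_indicator_lattice:
  fixes a b :: real and g :: "nat \<Rightarrow> real"
  assumes "a > 0"
  shows "(\<integral>x. (\<Sum>k\<le>n. g k * indicator {(2 * real k - b) / a ..< (2 * real k - b) / a + 2 / a} x) \<partial>lborel) =
         2 / a * (\<Sum>k\<le>n. g k)"
proof -
  have "has_bochner_integral lborel
      (\<lambda>x. \<Sum>k\<le>n. g k * indicator {(2 * real k - b) / a ..< (2 * real k - b) / a + 2 / a} x)
      (\<Sum>k\<le>n. g k * (2 / a))"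
  proof (intro has_bochner_integral_sum has_bochner_integral_mult_right)
    fix k
    show "has_bochner_integral lborel (indicator {(2 * real k - b) / a ..< (2 * real k - b) / a + 2 / a}) (2 / a)"
      using assms has_bochner_integral_real_indicator
        [of "{(2 * real k - b) / a ..< (2 * real k - b) / a + 2 / a}" lborel] by simp
  qed
  then show ?thesis
    by (simp only: has_bochner_integral_integral_eq sum_distrib_right[symmetric] mult.commute)
qed

text \<open>The lattice sum is the integral of a step function which, by the flatness of the weights on the scale
  of the fourth root of \<open>n\<close>, converges to the indicator of the set off its boundary.\<close>
lemma cw_lattice_sum_tendsto:
  fixes B :: "real set" and a :: "nat \<Rightarrow> real"
  assumes B: "B \<in> sets borel" and bdd: "bounded B" and fr: "emeasure lborel (frontier B) = 0"
  defines "a \<equiv> \<lambda>n. real n powr (1/4)"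
  shows "(\<lambda>n. 2 / a n * (\<Sum>k\<le>n. if (2 * real k - real n) / a n \<in> B
            then real (n choose k) / real (n choose (n div 2)) * exp ((2 * real k - real n)\<^sup>2 / (2 * real n)) else 0))
         \<longlonglongrightarrow> measure lborel B"
proof -
  have a0: "a n > 0" if "n > 0" for n
    using that by (simp add: a_def)
  have a1: "a n \<ge> 1" if "n > 0" for n
    using that by (simp add: a_def ge_one_powr_ge_zero)
  have a4: "real n = a n ^ 4" if "n > 0" for n
    using that by (simp add: a_def powr_powr flip: powr_numeral)
  obtain R where R: "R \<ge> 0" "\<And>z. z \<in> B \<Longrightarrow> \<bar>z\<bar> \<le> R"
    using bdd by (auto simp: bounded_pos intro: less_imp_le)
  \<comment> \<open>\<open>v\<close> is the weight relative to the central coefficient,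
    \<open>F n\<close> the step function with value \<open>g n k\<close> on cell \<open>k\<close>,
    \<open>j n x\<close> the index of the cell of \<open>x\<close>, and \<open>r n x\<close> its
    left endpoint.\<close>
  define v where "v n k = real (n choose k) / real (n choose (n div 2)) * exp ((2 * real k - real n)\<^sup>2 / (2 * real n))" for n k
  define g where "g n k = (if (2 * real k - real n) / a n \<in> B then v n k else 0)" for n k
  define F where "F n x = (\<Sum>k\<le>n. g n k *
     indicator {(2 * real k - real n) / a n ..< (2 * real k - real n) / a n + 2 / a n} x)" for n x
  define j where "j n x = \<lfloor>(a n * x + real n) / 2\<rfloor>" for n x
  define r where "r n x = (2 * real_of_int (j n x) - real n) / a n" for n x
  have F_eq: "F n x = (if 0 \<le> j n x \<and> j n x \<le> int n then g n (nat (j n x)) else 0)" if "n > 0" for n x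
    unfolding F_def j_def by (rule sum_indicator_lattice[OF a0[OF that]])
  have r_bounds: "x - 2 / a n \<le> r n x" "r n x \<le> x" if "n > 0" for n x
  proof -
    have "a n * x - 2 \<le> 2 * real_of_int (j n x) - real n"
      unfolding j_def using floor_correct[of "(a n * x + real n) / 2"] by (simp add: field_simps)
    then have "(a n * x - 2) / a n \<le> r n x"
      unfolding r_def using a0[OF that] by (intro divide_right_mono) auto
    then show "x - 2 / a n \<le> r n x"
      using a0[OF that] by (simp add: diff_divide_distrib)
    have "2 * real_of_int (j n x) - real n \<le> a n * x"
      unfolding j_def using floor_correct[of "(a n * x + real n) / 2"] by (simp add: field_simps)
    then have "r n x \<le> a n * x / a n"
      unfolding r_def using a0[OF that] by (intro divide_right_mono) auto
    then show "r n x \<le> x"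
      using a0[OF that] by simp
  qed
  have C: "real (n choose (n div 2)) > 0" for n
    by simp
  \<comment> \<open>Both bounds tend to 1 when the rescaled position stays bounded. The lower one is
    \<open>binomial_ge_central\<close>, the exponential being at least 1; the upper one is
    maximality of the central coefficient.\<close>
  have v_bounds: "1 - ((2 * real k - real n) / a n)\<^sup>2 / (a n)\<^sup>2 \<le> v n k"
    "0 \<le> v n k" "v n k \<le> exp (((2 * real k - real n) / a n)\<^sup>2 / (a n)\<^sup>2)"
    if "n > 0" "k \<le> n" for n k
  proof -
    define q where "q = (2 * real k - real n)\<^sup>2 / real n"
    have q: "((2 * real k - real n) / a n)\<^sup>2 / (a n)\<^sup>2 = q"
      unfolding q_def power_divide a4[OF that(1)] by (simp add: eval_nat_numeral)
    have "q \<ge> 0" by (simp add: q_def)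
    have v: "v n k = real (n choose k) / real (n choose (n div 2)) * exp (q / 2)"
      by (simp add: v_def q_def mult.commute)
    have "1 - q \<le> real (n choose k) / real (n choose (n div 2))"
      using binomial_ge_central[OF that(2)] C[of n] unfolding q_def by (simp add: pos_le_divide_eq)
    also have "\<dots> \<le> v n k"
      unfolding v using \<open>q \<ge> 0\<close>
        mult_left_mono[of 1 "exp (q / 2)" "real (n choose k) / real (n choose (n div 2))"] by simp
    finally show "1 - ((2 * real k - real n) / a n)\<^sup>2 / (a n)\<^sup>2 \<le> v n k"
      unfolding q .
    show "0 \<le> v n k" unfolding v by simp
    have "real (n choose k) / real (n choose (n div 2)) \<le> 1"
      using binomial_maximum[of n k] C[of n] by simp
    then have "v n k \<le> 1 * exp q"
      unfolding v using \<open>q \<ge> 0\<close> by (intro mult_mono) auto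
    then show "v n k \<le> exp (((2 * real k - real n) / a n)\<^sup>2 / (a n)\<^sup>2)"
      unfolding q by simp
  qed
  have r_nat: "(2 * real (nat (j n x)) - real n) / a n = r n x" if "0 \<le> j n x" for n x
    using that by (simp add: r_def)
  have v_r: "1 - (r n x)\<^sup>2 / (a n)\<^sup>2 \<le> v n (nat (j n x))"
    "v n (nat (j n x)) \<le> exp ((r n x)\<^sup>2 / (a n)\<^sup>2)"
    if "n > 0 \<and> 0 \<le> j n x \<and> j n x \<le> int n" for n x
  proof -
    have k: "nat (j n x) \<le> n" and n: "n > 0" and j: "0 \<le> j n x" using that by auto
    show "1 - (r n x)\<^sup>2 / (a n)\<^sup>2 \<le> v n (nat (j n x))"
      using v_bounds(1)[OF n k] unfolding r_nat[OF j] .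
    show "v n (nat (j n x)) \<le> exp ((r n x)\<^sup>2 / (a n)\<^sup>2)"
      using v_bounds(3)[OF n k] unfolding r_nat[OF j] .
  qed
  \<comment> \<open>If \<open>F n x\<close> is nonzero, \<open>r n x\<close> lies in
    \<open>B\<close>, and \<open>x\<close> exceeds it by at most \<open>2 / a n\<close>, which is at
    most 2.\<close>
  have bound: "norm (F n x) \<le> exp (R\<^sup>2) * indicator {- R - 2..R + 2} x" if n: "n > 0" for n x
  proof (cases "0 \<le> j n x \<and> j n x \<le> int n \<and> r n x \<in> B")
    case True
    have F: "F n x = v n (nat (j n x))" and k: "nat (j n x) \<le> n"
      using True r_nat[of n x] by (auto simp: F_eq[OF n] g_def)
    have rR: "\<bar>r n x\<bar> \<le> R" using True R by auto
    have "2 / a n \<le> 2" using a1[OF n] by (simp add: field_simps)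
    then have "x \<in> {- R - 2..R + 2}"
      using r_bounds[OF n, of x] rR by (auto simp: abs_le_iff)
    moreover have "v n (nat (j n x)) \<le> exp (R\<^sup>2)"
    proof -
      have "(r n x)\<^sup>2 / (a n)\<^sup>2 \<le> R\<^sup>2 / 1"
        using rR a1[OF n] by (intro frac_le) (auto simp: abs_le_square_iff[symmetric])
      then have "exp ((r n x)\<^sup>2 / (a n)\<^sup>2) \<le> exp (R\<^sup>2)" by simp
      then show ?thesis
        using v_r(2)[of n x] n True by linarith
    qed
    ultimately show ?thesis
      unfolding F using v_bounds(2)[OF n k] by simp
  next
    case False
    then have "F n x = 0"
      using r_nat[of n x] by (auto simp: F_eq[OF n] g_def)
    then show ?thesis by (simp add: indicator_def)
  qed
  have lim: "(\<lambda>n. F n x) \<longlonglongrightarrow> indicator B x" if x: "x \<notin> frontier B" for x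
  proof -
    have inv: "(\<lambda>n. 1 / a n) \<longlonglongrightarrow> 0"
      unfolding a_def by real_asymp
    have r: "(\<lambda>n. r n x) \<longlonglongrightarrow> x"
    proof (rule tendsto_sandwich)
      show "(\<lambda>n. x - 2 * (1 / a n)) \<longlonglongrightarrow> x"
        using tendsto_diff[OF tendsto_const tendsto_mult_left[OF inv, of 2], of x] by simp
      show "eventually (\<lambda>n. x - 2 * (1 / a n) \<le> r n x) sequentially"
        using eventually_gt_at_top[of 0] by eventually_elim (use r_bounds in simp)
      show "eventually (\<lambda>n. r n x \<le> x) sequentially"
        using eventually_gt_at_top[of 0] by eventually_elim (use r_bounds in simp)
    qed simp
    \<comment> \<open>The lattice extends to distance \<open>n\<close>, far beyond
      \<open>a n * x\<close>, so the cell index eventually lies in the range of summation.\<close>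
    have "(\<lambda>n. (\<bar>x\<bar> * real n powr (1/4) + 2) / real n) \<longlonglongrightarrow> 0"
      by real_asymp
    then have "eventually (\<lambda>n. (\<bar>x\<bar> * a n + 2) / real n < 1) sequentially"
      unfolding a_def by (rule order_tendstoD) simp
    then have j: "eventually (\<lambda>n. n > 0 \<and> 0 \<le> j n x \<and> j n x \<le> int n) sequentially"
      using eventually_gt_at_top[of 0]
    proof eventually_elim
      case (elim n)
      then have "\<bar>x\<bar> * a n + 2 < real n" by simp
      moreover have "\<bar>a n * x\<bar> = \<bar>x\<bar> * a n"
        using a0[OF elim(2)] by (simp add: abs_mult)
      ultimately have "\<bar>a n * x\<bar> < real n" by linarith
      then have "0 \<le> a n * x + real n" "a n * x + real n < 2 * (real n + 1)"
        unfolding abs_less_iff by auto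
      then have "0 \<le> j n x" "j n x < int n + 1"
        unfolding j_def le_floor_iff floor_less_iff by auto
      then show ?case using elim by simp
    qed
    have q: "(\<lambda>n. (r n x)\<^sup>2 / (a n)\<^sup>2) \<longlonglongrightarrow> 0"
      using tendsto_mult[OF tendsto_power[OF r, of 2] tendsto_power[OF inv, of 2]]
      by (simp add: power_divide)
    have v: "(\<lambda>n. v n (nat (j n x))) \<longlonglongrightarrow> 1"
    proof (rule tendsto_sandwich)
      show "eventually (\<lambda>n. 1 - (r n x)\<^sup>2 / (a n)\<^sup>2 \<le> v n (nat (j n x))) sequentially"
        using j by eventually_elim (rule v_r)
      show "eventually (\<lambda>n. v n (nat (j n x)) \<le> exp ((r n x)\<^sup>2 / (a n)\<^sup>2)) sequentially"
        using j by eventually_elim (rule v_r)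
      show "(\<lambda>n. 1 - (r n x)\<^sup>2 / (a n)\<^sup>2) \<longlonglongrightarrow> 1"
        using tendsto_diff[OF tendsto_const q, of 1] by simp
      show "(\<lambda>n. exp ((r n x)\<^sup>2 / (a n)\<^sup>2)) \<longlonglongrightarrow> 1"
        using tendsto_exp[OF q] by simp
    qed
    have F: "eventually (\<lambda>n. F n x = (if r n x \<in> B then v n (nat (j n x)) else 0)) sequentially"
      using j by eventually_elim (simp add: F_eq g_def r_def)
    \<comment> \<open>Both sets are open, so \<open>r n x\<close> eventually lies in the same one as
      its limit \<open>x\<close>.\<close>
    consider "x \<in> interior B" | "x \<in> - closure B"
      using x by (auto simp: frontier_def)
    then show ?thesis
    proof cases
      case 1
      have "eventually (\<lambda>n. r n x \<in> interior B) sequentially"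
        by (rule topological_tendstoD[OF r _ 1]) simp
      then have "eventually (\<lambda>n. F n x = v n (nat (j n x))) sequentially"
        using F by eventually_elim (use interior_subset in auto)
      moreover have "x \<in> B" using 1 interior_subset by auto
      ultimately show ?thesis using v by (simp add: tendsto_cong)
    next
      case 2
      have "eventually (\<lambda>n. r n x \<in> - closure B) sequentially"
        by (rule topological_tendstoD[OF r _ 2]) auto
      then have "eventually (\<lambda>n. F n x = 0) sequentially"
        using F by eventually_elim (use closure_subset in auto)
      moreover have "x \<notin> B" using 2 closure_subset by auto
      ultimately show ?thesis by (simp add: tendsto_eventually)
    qed
  qed
  \<comment> \<open>Convergence off the frontier is convergence almost everywhere, the frontier
    being a null set. The shift to \<open>Suc n\<close> meets the positivity assumption of
    \<open>bound\<close>.\<close>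
  have "(\<lambda>n. \<integral>x. F (Suc n) x \<partial>lborel) \<longlonglongrightarrow> (\<integral>x. indicator B x \<partial>lborel)"
  proof (rule integral_dominated_convergence[where w = "\<lambda>x. exp (R\<^sup>2) * indicator {- R - 2..R + 2} x"])
    have "AE x in lborel. x \<notin> frontier B"
      using fr by (intro AE_not_in null_setsI) auto
    then show "AE x in lborel. (\<lambda>n. F (Suc n) x) \<longlonglongrightarrow> indicator B x"
      by eventually_elim (rule LIMSEQ_Suc, rule lim)
    show "AE x in lborel. norm (F (Suc n) x) \<le> exp (R\<^sup>2) * indicator {- R - 2..R + 2} x" for n
      using bound[OF zero_less_Suc] by (rule AE_I2)
    show "(\<lambda>x. F (Suc n) x) \<in> borel_measurable lborel" for n
      unfolding F_def by measurable
  qed (use B in \<open>auto intro!: integrable_real_indicator simp: emeasure_lborel_Icc_eq\<close>)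
  then have "(\<lambda>n. \<integral>x. F (Suc n) x \<partial>lborel) \<longlonglongrightarrow> measure lborel B"
    by simp
  moreover have "(\<integral>x. F (Suc n) x \<partial>lborel) = 2 / a (Suc n) * (\<Sum>k\<le>Suc n. g (Suc n) k)" for n
    unfolding F_def by (rule integral_sum_indicator_lattice) (simp add: a0)
  ultimately have "(\<lambda>n. 2 / a (Suc n) * (\<Sum>k\<le>Suc n. g (Suc n) k)) \<longlonglongrightarrow> measure lborel B"
    by (simp only:)
  then have "(\<lambda>n. 2 / a n * (\<Sum>k\<le>n. g n k)) \<longlonglongrightarrow> measure lborel B"
    by (rule LIMSEQ_imp_Suc)
  then show ?thesis
    unfolding g_def v_def .
qed

section \<open>The quotient of the two limits\<close>

theorem theorem4p5:
  fixes B :: "real set"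
  assumes "B \<in> sets borel"
    and "compact (closure B)"
    and "emeasure lborel (frontier B) = 0"
  shows "(\<lambda>n. sqrt (real n) *
            cw_prob n (\<lambda>M. real_of_int M / real n powr (1/4) \<in> B))
         \<longlonglongrightarrow> 2 / (12 powr (1/4) * Gamma (1/4)) * measure lborel B"
proof -
  define a where "a n = real n powr (1/4)" for n
  define c where "c n = real (n choose (n div 2)) * sqrt (real n) / 2 ^ n" for n
  define S where "S n = (\<Sum>k\<le>n. if (2 * real k - real n) / a n \<in> B
      then real (n choose k) / real (n choose (n div 2)) * exp ((2 * real k - real n)\<^sup>2 / (2 * real n)) else 0)" for n
  define J where "J n = (\<integral>y. cosh (y / a n) ^ n * exp (- ((a n)\<^sup>2 * y\<^sup>2 / 2)) \<partial>lborel)" for n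
  have "bounded B"
    using assms(2) bounded_subset[OF compact_imp_bounded closure_subset] by blast
  then have S: "(\<lambda>n. 2 / a n * S n) \<longlonglongrightarrow> measure lborel B"
    unfolding S_def a_def using assms by (intro cw_lattice_sum_tendsto)
  have J: "J \<longlonglongrightarrow> 12 powr (1/4) * Gamma (1/4) / 2"
    unfolding J_def a_def by (rule cw_partition_integral_tendsto)
  have c: "c \<longlonglongrightarrow> sqrt (2 / pi)"
    unfolding c_def by (rule central_binomial_asymp)
  have Z: "12 powr (1/4) * Gamma (1/4) / 2 \<noteq> (0 :: real)"
  proof -
    have "12 powr (1/4) * Gamma (1/4) / 2 > (0 :: real)"
      by (intro divide_pos_pos mult_pos_pos Gamma_real_pos) auto
    then show ?thesis by (metis less_irrefl)
  qed
  \<comment> \<open>The scaled probability is regrouped into convergent factors: \<open>c n\<close>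
    absorbs \<open>sqrt n\<close> and \<open>2 ^ n\<close>, while the \<open>a n\<close> of the
    partition function goes with \<open>S n\<close> as the mesh \<open>2 / a n\<close>, at the cost
    of a factor \<open>1 / 2\<close>.\<close>
  have "(\<lambda>n. c n * (sqrt (2 * pi) / 2) * (2 / a n * S n) / J n) \<longlonglongrightarrow>
      sqrt (2 / pi) * (sqrt (2 * pi) / 2) * measure lborel B / (12 powr (1/4) * Gamma (1/4) / 2)"
    by (intro tendsto_intros S J c Z)
  also have "sqrt (2 / pi) * (sqrt (2 * pi) / 2) = 1"
    by (simp flip: real_sqrt_mult)
  also have "1 * measure lborel B / (12 powr (1/4) * Gamma (1/4) / 2) =
      2 / (12 powr (1/4) * Gamma (1/4)) * measure lborel B"
    by simp
  finally have "(\<lambda>n. c n * (sqrt (2 * pi) / 2) * (2 / a n * S n) / J n) \<longlonglongrightarrow>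
      2 / (12 powr (1/4) * Gamma (1/4)) * measure lborel B" .
  moreover have "eventually (\<lambda>n. c n * (sqrt (2 * pi) / 2) * (2 / a n * S n) / J n =
      sqrt (real n) * cw_prob n (\<lambda>M. real_of_int M / real n powr (1/4) \<in> B)) sequentially"
    using eventually_gt_at_top[of 0]
  proof eventually_elim
    case (elim n)
    have a0: "a n > 0" using elim by (simp add: a_def)
    have num: "(\<Sum>k\<le>n. real (n choose k) * (if real_of_int (2 * int k - int n) / real n powr (1/4) \<in> B
        then exp ((2 * real k - real n)\<^sup>2 / (2 * real n)) else 0)) = real (n choose (n div 2)) * S n"
      unfolding S_def sum_distrib_left by (intro sum.cong) (auto simp: a_def)
    have "cw_prob n (\<lambda>M. real_of_int M / real n powr (1/4) \<in> B) =
        real (n choose (n div 2)) * S n / (2 ^ n * a n / sqrt (2 * pi) * J n)"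
      unfolding cw_prob_eq_binomial_sum num J_def cw_partition_function[OF elim a_def] ..
    then show ?case
      using a0 by (simp add: c_def)
  qed
  ultimately show ?thesis
    by (rule Lim_transform_eventually)
qed

end
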